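(* Let $n\geq 2$ and $m\geq n+1$ be integers, let $\mathbb{K}$ be an infinite field whose characteristic does not divide $m$, and let $R=\mathbb{K}[x_1,\ldots,x_n]$. Let $\mathcal{A}$ be a generic central hyperplane arrangement in $\mathbb{K}^n$ defined by $m$ linear forms $l_1,\ldots,l_m\in R$, and let $f=l_1\cdots l_m$. Then $r(\mathcal{A})=m-n+1$, where $r(\mathcal{A})$ is the initial degree of the module of first syzygies of the partial derivatives of $f$.
   Context: A central hyperplane arrangement of size $m$ in $\mathbb{K}^n$ is given by nonzero, pairwise non-proportional linear forms $l_1,\ldots,l_m\in R=\mathbb{K}[x_1,\ldots,x_n]$; its defining polynomial is $f=l_1\cdots l_m$. It is generic if any $n$ of the forms $l_1,\ldots,l_m$ are $\mathbb{K}$-linearly independent. $J_f=\langle \partial f/\partial x_1,\ldots,\partial f/\partial x_n\rangle\subset R$ is the Jacobian ideal, and $\mathrm{Syz}(J_f)=\{(P_1,\ldots,P_n)\in R^n : \sum_i P_i\,\partial f/\partial x_i=0\}$, graded so that $(P_1,\ldots,P_n)$ has degree $r$ if all $P_i$ are forms of degree $r$ (or zero). Then $r(\mathcal{A})=\min\{r : (\mathrm{Syz}(J_f))_r\neq 0\}$. *)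

theory Defs
  imports Complex_Main "HOL-Library.Poly_Mapping"
begin

text \<open>
  Polynomials over \<open>'a\<close> in the variables \<open>x\<^sub>0, x\<^sub>1, \<dots>\<close>: finitely supported functions from
  exponent vectors to coefficients, with the convolution product of \<^theory>\<open>HOL-Library.Poly_Mapping\<close>.
\<close>

type_synonym 'a mpol = "(nat \<Rightarrow>\<^sub>0 nat) \<Rightarrow>\<^sub>0 'a"

text \<open>The ring \<open>K[x\<^sub>0, \<dots>, x\<^bsub>n-1\<^esub>]\<close>.\<close>

definition mpol_ring :: "nat \<Rightarrow> 'a::zero mpol set" where
  "mpol_ring n = {p. \<forall>a\<in>Poly_Mapping.keys p. Poly_Mapping.keys a \<subseteq> {..<n}}"

definition mpol_scale :: "'a::field \<Rightarrow> 'a mpol \<Rightarrow> 'a mpol" where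
  "mpol_scale c p = Poly_Mapping.single 0 c * p"

interpretation mpol: vector_space mpol_scale
  by unfold_locales
    (simp_all add: mpol_scale_def single_add distrib_left distrib_right mult_single
      mult.assoc [symmetric])

text \<open>
  The partial derivative with respect to \<open>x\<^sub>i\<close>. Subtraction of exponents truncates only in monomials
  without \<open>x\<^sub>i\<close>, whose coefficient becomes \<open>0\<close>.
\<close>

definition mpol_pderiv :: "nat \<Rightarrow> 'a::field mpol \<Rightarrow> 'a mpol" where
  "mpol_pderiv i p =
    (\<Sum>a\<in>Poly_Mapping.keys p.
      Poly_Mapping.single (a - Poly_Mapping.single i 1)
        (of_nat (Poly_Mapping.lookup a i) * Poly_Mapping.lookup p a))"

text \<open>Forms of degree \<open>r\<close>; zero is a form of every degree.\<close>

definition homogeneous :: "nat \<Rightarrow> 'a::zero mpol \<Rightarrow> bool" where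
  "homogeneous r p \<longleftrightarrow> (\<forall>a\<in>Poly_Mapping.keys p. (\<Sum>i\<in>Poly_Mapping.keys a. Poly_Mapping.lookup a i) = r)"

definition central_arrangement :: "nat \<Rightarrow> nat \<Rightarrow> (nat \<Rightarrow> 'a::field mpol) \<Rightarrow> bool" where
  "central_arrangement n m l \<longleftrightarrow>
    (\<forall>i<m. l i \<in> mpol_ring n \<and> homogeneous 1 (l i) \<and> l i \<noteq> 0) \<and>
    (\<forall>i<m. \<forall>j<m. i \<noteq> j \<longrightarrow> (\<nexists>c. l i = mpol_scale c (l j)))"

text \<open>
  In a central arrangement the forms \<open>l i\<close> (\<open>i < m\<close>) are distinct, so that linear independence of
  the family \<open>(l i)\<close>, \<open>i \<in> S\<close>, is linear independence of the set \<open>l ` S\<close>.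
\<close>

definition generic_arrangement :: "nat \<Rightarrow> nat \<Rightarrow> (nat \<Rightarrow> 'a::field mpol) \<Rightarrow> bool" where
  "generic_arrangement n m l \<longleftrightarrow> central_arrangement n m l \<and>
    (\<forall>S. S \<subseteq> {..<m} \<and> card S = n \<longrightarrow> mpol.independent (l ` S))"

definition defining_poly :: "nat \<Rightarrow> (nat \<Rightarrow> 'a::field mpol) \<Rightarrow> 'a mpol" where
  "defining_poly m l = (\<Prod>i<m. l i)"

text \<open>
  The syzygies \<open>(P\<^sub>0, \<dots>, P\<^bsub>n-1\<^esub>)\<close> of the partial derivatives of \<open>f\<close>. Tuples of length \<open>n\<close> are
  represented by functions that vanish from \<open>n\<close> on, so that the zero tuple is \<open>\<lambda>_. 0\<close>.
\<close>

definition jacobian_syz :: "nat \<Rightarrow> 'a::field mpol \<Rightarrow> (nat \<Rightarrow> 'a mpol) set" where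
  "jacobian_syz n f =
    {P. (\<forall>i<n. P i \<in> mpol_ring n) \<and> (\<forall>i\<ge>n. P i = 0) \<and> (\<Sum>i<n. P i * mpol_pderiv i f) = 0}"

definition jacobian_syz_deg :: "nat \<Rightarrow> 'a::field mpol \<Rightarrow> nat \<Rightarrow> (nat \<Rightarrow> 'a mpol) set" where
  "jacobian_syz_deg n f r = {P \<in> jacobian_syz n f. \<forall>i<n. homogeneous r (P i)}"

definition syz_initial_degree :: "nat \<Rightarrow> nat \<Rightarrow> (nat \<Rightarrow> 'a::field mpol) \<Rightarrow> nat" where
  "syz_initial_degree n m l =
    (LEAST r. jacobian_syz_deg n (defining_poly m l) r \<noteq> {\<lambda>_. 0})"

end

theory Submission
  imports Defs "HOL-Computational_Algebra.Polynomial"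
begin

text \<open>
  A syzygy \<open>(P\<^sub>0, \<dots>, P\<^bsub>n-1\<^esub>)\<close> of the partial derivatives of \<open>f = l\<^sub>1 \<cdots> l\<^sub>m\<close> is a polynomial vector field \<open>\<theta>\<close>
  that annihilates \<open>f\<close>. The theorem says that the least degree of a nonzero homogeneous field of this
  kind is \<open>m - n + 1\<close>.

  Lower bound. If \<open>\<theta>\<close> annihilates \<open>f\<close>, it is tangent to each hyperplane of the arrangement
  (\<open>tangent_if_annihilates\<close>). On each line in which \<open>n - 1\<close> of the hyperplanes meet, \<open>\<theta>\<close> is therefore
  radial, that is, the minors \<open>x\<^sub>i P\<^sub>j - x\<^sub>j P\<^sub>i\<close> vanish there. For a generic arrangement these lines form a
  star configuration, and a form vanishing on all of them has degree at least \<open>m - n + 2\<close> or is zero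
  (\<open>vanishes_if_on_lines\<close>): in a flat of dimension at least two, a general line meets the hyperplanes
  not containing the flat in distinct points, which are too many zeros for a polynomial of small
  degree, and so vanishing spreads from the smaller flats to the larger ones. Hence if \<open>\<theta>\<close> has degree
  at most \<open>m - n\<close>, then all minors are zero and \<open>\<theta>\<close> is proportional to the Euler field at each point.
  The Euler field multiplies \<open>f\<close> by \<open>m\<close>, which is not zero in \<open>K\<close>, and so \<open>\<theta> = 0\<close>
  (\<open>low_degree_annihilator_zero\<close>).

  Upper bound. Let \<open>D\<close> be the derivative in the direction of one of those lines and \<open>g\<close> the product of the
  \<open>m - n + 1\<close> forms that do not vanish on it. Then \<open>g D\<close> multiplies \<open>f\<close> by \<open>D g\<close>, and subtracting
  \<open>(D g) / m\<close> times the Euler field gives a field of degree \<open>m - n + 1\<close> that annihilates \<open>f\<close>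
  (\<open>ex_syzygy\<close>).

  The lower bound is a statement about values at points: \<open>K\<close> is infinite, so polynomials
  are determined by their values, and sufficiently general points and lines exist.
\<close>

section \<open>Linear forms as coefficient vectors\<close>

text \<open>
  Vectors of \<open>K\<^sup>n\<close> are functions on \<open>nat\<close> of which only the first \<open>n\<close> values matter; no type of
  dimension \<open>n\<close> is involved, since \<open>n\<close> is a variable.
\<close>

definition dot :: "nat \<Rightarrow> (nat \<Rightarrow> 'k::comm_ring_1) \<Rightarrow> (nat \<Rightarrow> 'k) \<Rightarrow> 'k" where
  "dot n a x = (\<Sum>i<n. a i * x i)"

lemma dot_add_scaled: "dot n a (\<lambda>i. x i + t * q i) = dot n a x + t * dot n a q"
  by (simp add: dot_def distrib_left sum.distrib sum_distrib_left mult.left_commute)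

lemma dot_diff_scaled: "dot n a (\<lambda>i. s * x i - t * q i) = s * dot n a x - t * dot n a q"
  by (simp add: dot_def right_diff_distrib sum_subtractf sum_distrib_left mult.left_commute)

lemma dot_diff_scaled_left: "dot n (\<lambda>i. s * a i - t * b i) x = s * dot n a x - t * dot n b x"
  by (simp add: dot_def left_diff_distrib sum_subtractf sum_distrib_left mult.assoc)

text \<open>
  A vector space over an infinite field is not a finite union of proper subspaces. For the
  induction step, take \<open>q\<close> off the old hyperplanes and \<open>v\<close> off the new one. If \<open>q\<close> lies on the new
  hyperplane, then \<open>v + t q\<close> stays off it for every \<open>t\<close> and is off the old ones for all but
  finitely many \<open>t\<close>.
\<close>

lemma avoid_hyperplanes:
  fixes B :: "(nat \<Rightarrow> 'k::field) set"
  assumes inf: "infinite (UNIV :: 'k set)" and fin: "finite B"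
    and zero: "(\<lambda>_. 0) \<in> V"
    and closed: "\<And>x y t. x \<in> V \<Longrightarrow> y \<in> V \<Longrightarrow> (\<lambda>i. x i + t * y i) \<in> V"
    and witness: "\<And>b. b \<in> B \<Longrightarrow> \<exists>v\<in>V. dot n b v \<noteq> 0"
  shows "\<exists>q\<in>V. \<forall>b\<in>B. dot n b q \<noteq> 0"
  using fin witness
proof (induction B rule: finite_induct)
  case empty
  show ?case using zero by auto
next
  case (insert b B)
  obtain q where q: "q \<in> V" "\<forall>c\<in>B. dot n c q \<noteq> 0"
    using insert.IH insert.prems by auto
  obtain v where v: "v \<in> V" "dot n b v \<noteq> 0"
    using insert.prems by auto
  show ?case
  proof (cases "dot n b q = 0")
    case False
    then show ?thesis using q by auto
  next
    case True
    have "finite ((\<lambda>c. - dot n c v / dot n c q) ` B)"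
      using insert.hyps by simp
    then obtain t where t: "t \<notin> (\<lambda>c. - dot n c v / dot n c q) ` B"
      using ex_new_if_finite[OF inf] by blast
    have "dot n c v + t * dot n c q \<noteq> 0" if c: "c \<in> B" for c
    proof
      assume "dot n c v + t * dot n c q = 0"
      then have "t = - dot n c v / dot n c q"
        using q(2) c by (simp add: field_simps eq_neg_iff_add_eq_0)
      then show False using t c by blast
    qed
    then have "\<forall>c\<in>insert b B. dot n c (\<lambda>i. v i + t * q i) \<noteq> 0"
      using True v(2) by (simp add: dot_add_scaled)
    then show ?thesis using closed[OF v(1) q(1)] by blast
  qed
qed

section \<open>Functions of bounded degree on lines\<close>

text \<open>
  The property of a form of degree \<open>d\<close> on which the lower bound rests: on each line it is a
  polynomial of degree at most \<open>d\<close> in the parameter. Working with this property keeps the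
  geometric argument at the level of functions and of polynomials in one variable.
\<close>

definition line_degree_le :: "nat \<Rightarrow> ((nat \<Rightarrow> 'k::field) \<Rightarrow> 'k) \<Rightarrow> bool" where
  "line_degree_le d F \<longleftrightarrow>
    (\<forall>x q. \<exists>p. degree p \<le> d \<and> (\<forall>t. poly p t = F (\<lambda>i. x i + t * q i)))"

lemma line_degree_le_add:
  assumes "line_degree_le d F" "line_degree_le d G"
  shows "line_degree_le d (\<lambda>x. F x + G x)"
  unfolding line_degree_le_def
proof (intro allI)
  fix x q
  obtain f g where "degree f \<le> d" "\<forall>t. poly f t = F (\<lambda>i. x i + t * q i)"
    "degree g \<le> d" "\<forall>t. poly g t = G (\<lambda>i. x i + t * q i)"
    using assms unfolding line_degree_le_def by metis
  then show "\<exists>p. degree p \<le> d \<and> (\<forall>t. poly p t = F (\<lambda>i. x i + t * q i) + G (\<lambda>i. x i + t * q i))"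
    by (intro exI[of _ "f + g"]) (auto intro: degree_add_le)
qed

lemma line_degree_le_mult:
  assumes "line_degree_le d F" "line_degree_le e G"
  shows "line_degree_le (d + e) (\<lambda>x. F x * G x)"
  unfolding line_degree_le_def
proof (intro allI)
  fix x q
  obtain f g where fg: "degree f \<le> d" "\<forall>t. poly f t = F (\<lambda>i. x i + t * q i)"
    "degree g \<le> e" "\<forall>t. poly g t = G (\<lambda>i. x i + t * q i)"
    using assms unfolding line_degree_le_def by metis
  then show "\<exists>p. degree p \<le> d + e \<and> (\<forall>t. poly p t = F (\<lambda>i. x i + t * q i) * G (\<lambda>i. x i + t * q i))"
    by (intro exI[of _ "f * g"]) (auto intro: order_trans[OF degree_mult_le] add_mono)
qed

lemma line_degree_le_const: "line_degree_le d (\<lambda>_. c)"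
  unfolding line_degree_le_def by (auto intro!: exI[of _ "[:c:]"])

lemma line_degree_le_coord: "line_degree_le 1 (\<lambda>x. x i)"
  unfolding line_degree_le_def
proof (intro allI)
  fix x q :: "nat \<Rightarrow> 'a"
  show "\<exists>p. degree p \<le> 1 \<and> (\<forall>t. poly p t = x i + t * q i)"
    by (intro exI[of _ "[:x i, q i:]"]) simp
qed

lemma line_degree_le_sum:
  "(\<And>j. j \<in> J \<Longrightarrow> line_degree_le d (F j)) \<Longrightarrow> line_degree_le d (\<lambda>x. \<Sum>j\<in>J. F j x)"
  by (induction J rule: infinite_finite_induct)
     (auto intro: line_degree_le_const line_degree_le_add)

lemma line_degree_le_scaled:
  "line_degree_le d F \<Longrightarrow> line_degree_le d (\<lambda>x. c * F x)"
  using line_degree_le_mult[OF line_degree_le_const[of 0 c]] by auto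

lemma line_degree_le_prod:
  "(\<And>j. j \<in> J \<Longrightarrow> line_degree_le (d j) (F j)) \<Longrightarrow>
    line_degree_le (\<Sum>j\<in>J. d j) (\<lambda>x. \<Prod>j\<in>J. F j x)"
  by (induction J rule: infinite_finite_induct)
     (auto intro: line_degree_le_const line_degree_le_mult)

lemma line_degree_le_power: "line_degree_le e (\<lambda>x. x i ^ e)"
proof (induction e)
  case (Suc e)
  then show ?case
    using line_degree_le_mult[OF line_degree_le_coord Suc.IH] by simp
qed (simp add: line_degree_le_const)

lemma vanishes_if_many_zeros_on_line:
  assumes F: "line_degree_le d F" and Z: "d < card Z"
    and zero: "\<And>t. t \<in> Z \<Longrightarrow> F (\<lambda>i. x i + t * q i) = 0"
  shows "F x = 0"
proof -
  obtain p where p: "degree p \<le> d" "\<And>t. poly p t = F (\<lambda>i. x i + t * q i)"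
    using F unfolding line_degree_le_def by metis
  have "p = 0"
  proof (rule ccontr)
    assume "p \<noteq> 0"
    then have "card Z \<le> card {t. poly p t = 0}"
      using zero by (intro card_mono poly_roots_finite) (auto simp: p(2))
    also have "\<dots> \<le> degree p"
      using \<open>p \<noteq> 0\<close> by (rule card_poly_roots_bound)
    finally show False using Z p(1) by simp
  qed
  then show ?thesis using p(2)[of 0] by simp
qed

lemma vanishes_if_zero_off_hyperplanes_on_line:
  fixes F :: "(nat \<Rightarrow> 'k::field) \<Rightarrow> 'k"
  assumes inf: "infinite (UNIV :: 'k set)" and F: "line_degree_le d F"
    and fin: "finite J" and q: "\<And>j. j \<in> J \<Longrightarrow> dot n (a j) q \<noteq> 0"
    and zero: "\<And>t. (\<forall>j\<in>J. dot n (a j) (\<lambda>i. x i + t * q i) \<noteq> 0) \<Longrightarrow> F (\<lambda>i. x i + t * q i) = 0"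
  shows "F x = 0"
proof -
  let ?E = "(\<lambda>j. - dot n (a j) x / dot n (a j) q) ` J"
  have "infinite (UNIV - ?E)"
    using inf fin by (simp add: Diff_infinite_finite)
  then obtain Z where Z: "Z \<subseteq> UNIV - ?E" "card Z = Suc d"
    using infinite_arbitrarily_large[of "UNIV - ?E" "Suc d"] by metis
  have "F (\<lambda>i. x i + t * q i) = 0" if t: "t \<in> Z" for t
  proof (rule zero, intro ballI notI)
    fix j assume j: "j \<in> J" and "dot n (a j) (\<lambda>i. x i + t * q i) = 0"
    then have "t = - dot n (a j) x / dot n (a j) q"
      using q by (simp add: dot_add_scaled field_simps eq_neg_iff_add_eq_0)
    then show False using t Z(1) j by blast
  qed
  then show ?thesis
    using vanishes_if_many_zeros_on_line[OF F, of Z x q] Z(2) by simp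
qed

section \<open>Vectors in general position\<close>

text \<open>
  The form \<open>l\<^sub>j\<close> with coefficient vector \<open>a j\<close> is \<open>dot n (a j)\<close>. That any \<open>n\<close> of the forms are linearly
  independent is used in two ways: they have no common zero except the origin, and they possess
  a dual basis. Both are assumed here, so that no dimension theory is needed below.
\<close>

locale general_position =
  fixes n m :: nat and a :: "nat \<Rightarrow> nat \<Rightarrow> 'k::field"
  assumes infinite_field: "infinite (UNIV :: 'k set)"
    and dim_le: "n \<le> m"
    and trivial_kernel: "\<lbrakk>T \<subseteq> {..<m}; card T = n; \<forall>s\<in>T. dot n (a s) x = 0; i < n\<rbrakk> \<Longrightarrow> x i = 0"
    and dual_basis: "\<lbrakk>T \<subseteq> {..<m}; card T = n; s \<in> T\<rbrakk> \<Longrightarrow>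
      \<exists>q. dot n (a s) q = 1 \<and> (\<forall>t\<in>T - {s}. dot n (a t) q = 0)"
begin

lemma dual_vector:
  assumes "T \<subseteq> {..<m}" "card T \<le> n" "s \<in> T"
  shows "\<exists>q. dot n (a s) q = 1 \<and> (\<forall>t\<in>T - {s}. dot n (a t) q = 0)"
proof -
  obtain T' where "T \<subseteq> T'" "T' \<subseteq> {..<m}" "card T' = n"
    using exists_subset_between[of T n "{..<m}"] assms dim_le by auto
  then show ?thesis using dual_basis[of T' s] assms(3) by blast
qed

text \<open>
  Fewer than \<open>n\<close> of the hyperplanes meet in a flat that is contained in none of the others, so
  \<open>avoid_hyperplanes\<close> applies inside the flat.
\<close>

lemma ex_point_off_hyperplanes:
  assumes S: "S \<subseteq> {..<m}" "card S < n"
  shows "\<exists>q. (\<forall>s\<in>S. dot n (a s) q = 0) \<and> (\<forall>j\<in>{..<m} - S. dot n (a j) q \<noteq> 0)"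
proof -
  have "\<exists>q\<in>{y. \<forall>s\<in>S. dot n (a s) y = 0}. \<forall>b\<in>a ` ({..<m} - S). dot n b q \<noteq> 0"
  proof (rule avoid_hyperplanes[OF infinite_field])
    fix b assume "b \<in> a ` ({..<m} - S)"
    then obtain j where j: "j < m" "j \<notin> S" "b = a j" by auto
    have "card (insert j S) \<le> n"
      using S card_insert_le_m1[of n S j] by simp
    then obtain q where "dot n (a j) q = 1" "\<forall>t\<in>insert j S - {j}. dot n (a t) q = 0"
      using dual_vector[of "insert j S" j] S j by auto
    then show "\<exists>v\<in>{y. \<forall>s\<in>S. dot n (a s) y = 0}. dot n b v \<noteq> 0"
      using j by (intro bexI[of _ q]) auto
  qed (auto simp: dot_add_scaled, simp add: dot_def)
  then show ?thesis by auto
qed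

text \<open>
  Let \<open>x\<close> be a point of the flat \<open>X\<close> cut out by \<open>S\<close>, not on any further hyperplane. A line through
  \<open>x\<close> in a general direction \<open>q\<close> of \<open>X\<close> meets the remaining \<open>m - card S\<close> hyperplanes in distinct
  points, at each of which \<open>F\<close> vanishes by assumption. Since \<open>card S \<le> n - 2\<close>, these are at least
  \<open>m - n + 2 > d\<close> zeros on one line, so \<open>F\<close> is zero on the line, in particular at \<open>x\<close>.
\<close>

lemma vanishes_on_flat_if_on_smaller_flats:
  assumes S: "S \<subseteq> {..<m}" "card S + 2 \<le> n"
    and F: "line_degree_le d F" and d: "d + n \<le> m + 1"
    and smaller: "\<And>j x. \<lbrakk>j \<in> {..<m} - S; \<forall>s\<in>insert j S. dot n (a s) x = 0\<rbrakk> \<Longrightarrow> F x = 0"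
    and x: "\<forall>s\<in>S. dot n (a s) x = 0"
  shows "F x = 0"
proof (cases "\<exists>j\<in>{..<m} - S. dot n (a j) x = 0")
  case True
  then show ?thesis using smaller x by auto
next
  case False
  define J where "J = {..<m} - S"
  have Jx: "dot n (a j) x \<noteq> 0" if "j \<in> J" for j
    using False that by (auto simp: J_def)
  have finS: "finite S" using S(1) finite_subset by blast
  \<comment> \<open>The vector \<open>c (j, k)\<close> represents the form on directions \<open>q\<close> whose zeros are those for which the
    line \<open>x + t q\<close> meets the hyperplanes \<open>j\<close> and \<open>k\<close> at the same parameter \<open>t\<close>. It is not zero on the
    flat, because \<open>card S + 2 \<le> n\<close> provides a vector dual to \<open>j\<close> in \<open>S \<union> {j, k}\<close>.\<close>
  define c where "c = (\<lambda>(j, k) i. dot n (a k) x * a j i - dot n (a j) x * a k i)"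
  define B where "B = a ` J \<union> c ` {(j, k) \<in> J \<times> J. j \<noteq> k}"
  have "\<exists>q\<in>{y. \<forall>s\<in>S. dot n (a s) y = 0}. \<forall>b\<in>B. dot n b q \<noteq> 0"
  proof (rule avoid_hyperplanes[OF infinite_field])
    have "finite {(j, k) \<in> J \<times> J. j \<noteq> k}"
      by (rule finite_subset[of _ "J \<times> J"]) (auto simp: J_def)
    then show "finite B" by (simp add: B_def J_def)
  next
    fix b assume "b \<in> B"
    then consider j where "j \<in> J" "b = a j"
      | j k where "j \<in> J" "k \<in> J" "j \<noteq> k" "b = c (j, k)"
      by (auto simp: B_def)
    then show "\<exists>v\<in>{y. \<forall>s\<in>S. dot n (a s) y = 0}. dot n b v \<noteq> 0"
    proof cases
      case 1
      obtain q where "\<forall>s\<in>S. dot n (a s) q = 0" "\<forall>j\<in>{..<m} - S. dot n (a j) q \<noteq> 0"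
        using ex_point_off_hyperplanes[OF S(1)] S(2) by auto
      then show ?thesis using 1 by (auto simp: J_def)
    next
      case 2
      let ?T = "insert j (insert k S)"
      have "card ?T \<le> n" using S(2) 2 finS by (simp add: J_def)
      then obtain q where q: "dot n (a j) q = 1" "\<forall>t\<in>?T - {j}. dot n (a t) q = 0"
        using dual_vector[of ?T j] S(1) 2 by (auto simp: J_def)
      then have "dot n b q = dot n (a k) x"
        using 2 by (simp add: c_def dot_diff_scaled_left)
      moreover have "\<forall>s\<in>S. dot n (a s) q = 0"
        using q(2) 2 by (auto simp: J_def)
      ultimately show ?thesis using Jx 2 by (intro bexI[of _ q]) auto
    qed
  qed (auto simp: dot_add_scaled, simp add: dot_def)
  then obtain q where q: "\<forall>s\<in>S. dot n (a s) q = 0" "\<forall>b\<in>B. dot n b q \<noteq> 0" by auto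
  have Jq: "dot n (a j) q \<noteq> 0" if "j \<in> J" for j
    using q(2) that by (auto simp: B_def)
  \<comment> \<open>The parameter at which the line meets the hyperplane \<open>j\<close>.\<close>
  define \<tau> where "\<tau> j = - dot n (a j) x / dot n (a j) q" for j
  have "inj_on \<tau> J"
  proof (rule inj_onI, rule ccontr)
    fix j k assume jk: "j \<in> J" "k \<in> J" "\<tau> j = \<tau> k" "j \<noteq> k"
    then have "dot n (a k) x * dot n (a j) q - dot n (a j) x * dot n (a k) q = 0"
      using Jq[of j] Jq[of k] by (simp add: \<tau>_def frac_eq_eq)
    then have "dot n (c (j, k)) q = 0"
      by (simp add: c_def dot_diff_scaled_left)
    then show False using q(2) jk by (auto simp: B_def)
  qed
  moreover have "card J = m - card S"
    using S(1) finS by (simp add: J_def card_Diff_subset)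
  ultimately have "d < card (\<tau> ` J)"
    using S(2) d by (simp add: card_image)
  then show ?thesis
  proof (rule vanishes_if_many_zeros_on_line[OF F])
    fix t assume "t \<in> \<tau> ` J"
    then obtain j where j: "j \<in> J" "t = \<tau> j" by auto
    show "F (\<lambda>i. x i + t * q i) = 0"
    proof (rule smaller)
      show "j \<in> {..<m} - S" using j by (simp add: J_def)
      show "\<forall>s\<in>insert j S. dot n (a s) (\<lambda>i. x i + t * q i) = 0"
        unfolding dot_add_scaled using x q(1) Jq j by (simp add: \<tau>_def)
    qed
  qed
qed

text \<open>
  Going up from the one-dimensional flats to the whole space, one hyperplane fewer at a time. This
  is the bound \<open>m - n + 2\<close> for the initial degree of the ideal of the star configuration formed by
  the lines in which \<open>n - 1\<close> of the hyperplanes meet.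
\<close>

lemma vanishes_if_on_lines:
  assumes n: "n \<ge> 1" and F: "line_degree_le d F" and d: "d + n \<le> m + 1"
    and lines: "\<And>S x. \<lbrakk>S \<subseteq> {..<m}; card S = n - 1; \<forall>s\<in>S. dot n (a s) x = 0\<rbrakk> \<Longrightarrow> F x = 0"
  shows "F x = 0"
proof -
  have "F y = 0" if "k \<le> n - 1" "S \<subseteq> {..<m}" "card S = n - 1 - k" "\<forall>s\<in>S. dot n (a s) y = 0"
    for k S y
    using that
  proof (induction k arbitrary: S y)
    case 0
    then show ?case using lines by simp
  next
    case (Suc k)
    have fin: "finite S" using Suc.prems(2) finite_subset by blast
    show ?case
    proof (rule vanishes_on_flat_if_on_smaller_flats[OF Suc.prems(2) _ F d _ Suc.prems(4)])
      show "card S + 2 \<le> n" using Suc.prems by simp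
      fix j z assume "j \<in> {..<m} - S" "\<forall>s\<in>insert j S. dot n (a s) z = 0"
      then show "F z = 0"
        using Suc.prems fin by (intro Suc.IH[of "insert j S" z]) auto
    qed
  qed
  from this[of "n - 1" "{}" x] show ?thesis by simp
qed

section \<open>Vector fields tangent to the arrangement\<close>

text \<open>
  On a line \<open>X\<close> in which \<open>n - 1\<close> of the hyperplanes meet, \<open>\<theta>\<close> is tangent to each of them, hence to
  \<open>X\<close>, and so \<open>\<theta> x\<close> is proportional to \<open>x\<close>. The \<open>2 \<times> 2\<close> minors of \<open>x\<close> and \<open>\<theta> x\<close> thus vanish on all these
  lines. Their degree \<open>r + 1 \<le> m - n + 1\<close> is too small for this unless they are zero.
\<close>

lemma tangent_field_radial:
  assumes n: "n \<ge> 1" and deg: "\<And>i. i < n \<Longrightarrow> line_degree_le r (\<lambda>x. \<theta> x i)" and r: "r + n \<le> m"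
    and tangent: "\<And>j x. j < m \<Longrightarrow> dot n (a j) x = 0 \<Longrightarrow> dot n (a j) (\<theta> x) = 0"
    and ij: "i < n" "j < n"
  shows "x i * \<theta> x j = x j * \<theta> x i"
proof -
  have "line_degree_le (1 + r) (\<lambda>x. x i * \<theta> x j + (- 1) * (x j * \<theta> x i))"
    using deg ij
    by (intro line_degree_le_add line_degree_le_scaled line_degree_le_mult line_degree_le_coord)
  then have "x i * \<theta> x j + (- 1) * (x j * \<theta> x i) = 0"
  proof (rule vanishes_if_on_lines[OF n])
    show "1 + r + n \<le> m + 1" using r by simp
    fix S x assume S: "S \<subseteq> {..<m}" "card S = n - 1" and x: "\<forall>s\<in>S. dot n (a s) x = 0"
    have fin: "finite S" using S(1) finite_subset by blast
    have "S \<noteq> {..<m}" using S(2) n dim_le by auto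
    then obtain t where t: "t < m" "t \<notin> S" using S(1) by auto
    have T: "insert t S \<subseteq> {..<m}" "card (insert t S) = n"
      using S t fin n by auto
    have \<theta>: "\<forall>s\<in>S. dot n (a s) (\<theta> x) = 0"
      using tangent x S(1) by auto
    show "x i * \<theta> x j + (- 1) * (x j * \<theta> x i) = 0"
    proof (cases "dot n (a t) x = 0")
      case True
      then have "x k = 0" if "k < n" for k
        using trivial_kernel[OF T] x that by simp
      then show ?thesis using ij by simp
    next
      case False
      \<comment> \<open>This combination of \<open>x\<close> and \<open>\<theta> x\<close> is killed by the \<open>n\<close> forms with index in \<open>insert t S\<close>.\<close>
      let ?v = "\<lambda>i. dot n (a t) (\<theta> x) * x i - dot n (a t) x * \<theta> x i"
      have v0: "\<forall>s\<in>insert t S. dot n (a s) ?v = 0"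
        unfolding dot_diff_scaled using x \<theta> by simp
      have v: "dot n (a t) (\<theta> x) * x k = dot n (a t) x * \<theta> x k" if "k < n" for k
        using trivial_kernel[OF T v0 that] by (rule eq_iff_diff_eq_0[THEN iffD2])
      have "dot n (a t) x * (x i * \<theta> x j) = x i * (dot n (a t) x * \<theta> x j)"
        by (rule mult.left_commute)
      also have "\<dots> = x j * (dot n (a t) (\<theta> x) * x i)"
        unfolding v[OF ij(2), symmetric] by (simp only: ac_simps)
      also have "\<dots> = dot n (a t) x * (x j * \<theta> x i)"
        unfolding v[OF ij(1)] by (rule mult.left_commute)
      finally show ?thesis using False by simp
    qed
  qed
  then show ?thesis by simp
qed

text \<open>
  The hypothesis says that the derivative of \<open>f = l\<^sub>1 \<cdots> l\<^sub>m\<close> along \<open>\<theta>\<close> is zero. At a point of the hyperplane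
  \<open>j\<close> every summand but the \<open>j\<close>-th contains the factor \<open>l\<^sub>j\<close>. This gives the claim where no
  other form vanishes, and the claim extends to all of the hyperplane along lines inside it.
\<close>

lemma tangent_if_annihilates:
  assumes n: "n \<ge> 2" and deg: "\<And>i. i < n \<Longrightarrow> line_degree_le r (\<lambda>x. \<theta> x i)"
    and annihilates: "\<And>x. (\<Sum>j<m. dot n (a j) (\<theta> x) * (\<Prod>k\<in>{..<m} - {j}. dot n (a k) x)) = 0"
    and j: "j < m" and x: "dot n (a j) x = 0"
  shows "dot n (a j) (\<theta> x) = 0"
proof -
  obtain q where q: "dot n (a j) q = 0" "\<And>k. k \<in> {..<m} - {j} \<Longrightarrow> dot n (a k) q \<noteq> 0"
    using ex_point_off_hyperplanes[of "{j}"] j n by auto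
  have "line_degree_le r (\<lambda>x. dot n (a j) (\<theta> x))"
    unfolding dot_def by (intro line_degree_le_sum line_degree_le_scaled deg) simp
  then show ?thesis
  proof (rule vanishes_if_zero_off_hyperplanes_on_line[OF infinite_field _ _ q(2)])
    fix t
    let ?y = "\<lambda>i. x i + t * q i"
    assume off: "\<forall>k\<in>{..<m} - {j}. dot n (a k) ?y \<noteq> 0"
    have y: "dot n (a j) ?y = 0" using q(1) x by (simp add: dot_add_scaled)
    have "(\<Prod>k\<in>{..<m} - {j'}. dot n (a k) ?y) = 0" if "j' \<noteq> j" for j'
      using y j that by (intro prod_zero) auto
    then have "(\<Sum>j'\<in>{..<m} - {j}. dot n (a j') (\<theta> ?y) * (\<Prod>k\<in>{..<m} - {j'}. dot n (a k) ?y)) = 0"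
      by (intro sum.neutral) auto
    then have "dot n (a j) (\<theta> ?y) * (\<Prod>k\<in>{..<m} - {j}. dot n (a k) ?y) = 0"
      using annihilates[of ?y] j by (simp add: sum.remove[of "{..<m}" j])
    then show "dot n (a j) (\<theta> ?y) = 0" using off by auto
  qed auto
qed

text \<open>
  By \<open>tangent_field_radial\<close>, \<open>\<theta>\<close> is proportional to the Euler field \<open>x \<mapsto> x\<close>. By Euler's formula, the
  derivative of \<open>f\<close> along \<open>\<theta>\<close> is then \<open>m\<close> times \<open>f\<close> times the factor of proportionality. Multiplying by a
  coordinate avoids this factor: \<open>m f(y) \<theta>\<^sub>i(y)\<close> is \<open>y\<^sub>i\<close> times the derivative, hence zero.
\<close>

lemma low_degree_annihilator_zero:
  assumes n: "n \<ge> 2" and deg: "\<And>i. i < n \<Longrightarrow> line_degree_le r (\<lambda>x. \<theta> x i)" and r: "r + n \<le> m"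
    and char: "of_nat m \<noteq> (0 :: 'k)"
    and annihilates: "\<And>x. (\<Sum>j<m. dot n (a j) (\<theta> x) * (\<Prod>k\<in>{..<m} - {j}. dot n (a k) x)) = 0"
    and i: "i < n"
  shows "\<theta> x i = 0"
proof -
  have radial: "y i * \<theta> y k = y k * \<theta> y i" if "k < n" for y k
    using n r i that tangent_if_annihilates[OF n deg annihilates]
    by (intro tangent_field_radial[of r \<theta>] deg) auto
  have zero: "\<theta> y i = 0" if off: "\<forall>j\<in>{..<m}. dot n (a j) y \<noteq> 0" for y
  proof -
    have L: "y i * dot n (a j) (\<theta> y) = \<theta> y i * dot n (a j) y" for j
    proof -
      have "y i * dot n (a j) (\<theta> y) = (\<Sum>k<n. a j k * (y i * \<theta> y k))"
        by (simp add: dot_def sum_distrib_left mult.left_commute)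
      also have "\<dots> = (\<Sum>k<n. a j k * (y k * \<theta> y i))"
        by (intro sum.cong) (auto simp: radial)
      also have "\<dots> = \<theta> y i * dot n (a j) y"
        by (simp add: dot_def sum_distrib_left ac_simps)
      finally show ?thesis .
    qed
    have "0 = y i * (\<Sum>j<m. dot n (a j) (\<theta> y) * (\<Prod>k\<in>{..<m} - {j}. dot n (a k) y))"
      by (simp add: annihilates)
    also have "\<dots> = (\<Sum>j<m. (y i * dot n (a j) (\<theta> y)) * (\<Prod>k\<in>{..<m} - {j}. dot n (a k) y))"
      by (simp add: sum_distrib_left mult.assoc)
    also have "\<dots> = (\<Sum>j<m. \<theta> y i * (\<Prod>k<m. dot n (a k) y))"
      by (intro sum.cong refl) (simp add: L mult.assoc prod.remove[of "{..<m}"])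
    also have "\<dots> = of_nat m * (\<theta> y i * (\<Prod>k<m. dot n (a k) y))"
      by simp
    finally show ?thesis using char off by auto
  qed
  obtain q where q: "\<And>j. j \<in> {..<m} \<Longrightarrow> dot n (a j) q \<noteq> 0"
    using ex_point_off_hyperplanes[of "{}"] n by auto
  show ?thesis
    by (rule vanishes_if_zero_off_hyperplanes_on_line[OF infinite_field deg[OF i] finite_lessThan q])
       (auto intro: zero)
qed

end

section \<open>Polynomials, their values and their derivatives\<close>

lemma sum_monomials:
  fixes p :: "'a \<Rightarrow>\<^sub>0 'b::comm_monoid_add"
  shows "(\<Sum>a\<in>Poly_Mapping.keys p. Poly_Mapping.single a (Poly_Mapping.lookup p a)) = p"
proof (rule poly_mapping_eqI)
  fix k
  have "(\<Sum>a\<in>Poly_Mapping.keys p. Poly_Mapping.lookup (Poly_Mapping.single a (Poly_Mapping.lookup p a)) k)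
    = (\<Sum>a\<in>Poly_Mapping.keys p. if a = k then Poly_Mapping.lookup p k else 0)"
    by (intro sum.cong) (auto simp: lookup_single when_def)
  also have "\<dots> = Poly_Mapping.lookup p k"
    by (auto simp: in_keys_iff)
  finally show "Poly_Mapping.lookup (\<Sum>a\<in>Poly_Mapping.keys p. Poly_Mapping.single a (Poly_Mapping.lookup p a)) k
    = Poly_Mapping.lookup p k"
    by (simp add: lookup_sum)
qed

lemma monomial_induct [case_names single add]:
  fixes p :: "'a \<Rightarrow>\<^sub>0 'b::comm_monoid_add"
  assumes single: "\<And>a c. P (Poly_Mapping.single a c)"
    and add: "\<And>p q. P p \<Longrightarrow> P q \<Longrightarrow> P (p + q)"
  shows "P p"
proof -
  have "P (\<Sum>a\<in>A. Poly_Mapping.single a (Poly_Mapping.lookup p a))" for A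
  proof (induction A rule: infinite_finite_induct)
    case (insert a A)
    then show ?case using single add by simp
  qed (use single[of _ 0] in simp_all)
  then show ?thesis by (metis sum_monomials)
qed

abbreviation mconst :: "'k::field \<Rightarrow> 'k mpol" where
  "mconst c \<equiv> Poly_Mapping.single 0 c"

abbreviation mvar :: "nat \<Rightarrow> 'k::field mpol" where
  "mvar i \<equiv> Poly_Mapping.single (Poly_Mapping.single i 1) 1"

lemma mconst_sum: "mconst (\<Sum>i\<in>I. c i) = (\<Sum>i\<in>I. mconst (c i))"
  by (induction I rule: infinite_finite_induct) (simp_all add: single_add)

lemma mconst_mult: "mconst (c * d) = mconst c * mconst d"
  by (simp add: mult_single)

text \<open>
  Monomials are evaluated in the variables with index below \<open>n\<close> only, that is, all others are set
  to \<open>1\<close>. The range of the product then does not depend on the monomial, and evaluation is a ring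
  homomorphism on all polynomials.
\<close>

definition eval :: "nat \<Rightarrow> (nat \<Rightarrow> 'k::field) \<Rightarrow> 'k mpol \<Rightarrow> 'k" where
  "eval n x p = (\<Sum>a\<in>Poly_Mapping.keys p.
    Poly_Mapping.lookup p a * (\<Prod>i<n. x i ^ Poly_Mapping.lookup a i))"

lemma eval_add: "eval n x (p + q) = eval n x p + eval n x q"
  unfolding eval_def
  by (rule setsum_keys_plus_distrib[of "\<lambda>a c. c * (\<Prod>i<n. x i ^ Poly_Mapping.lookup a i)"])
     (simp_all add: distrib_right)

lemma eval_single: "eval n x (Poly_Mapping.single a c) = c * (\<Prod>i<n. x i ^ Poly_Mapping.lookup a i)"
  by (simp add: eval_def)

lemma eval_const [simp]: "eval n x (mconst c) = c"
  by (simp add: eval_single)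

lemma eval_zero [simp]: "eval n x 0 = 0"
  by (simp add: eval_def)

lemma eval_one [simp]: "eval n x 1 = 1"
  using eval_const[of n x 1] by simp

lemma eval_var:
  assumes "i < n"
  shows "eval n x (mvar i) = x i"
proof -
  have "(\<Prod>j<n. x j ^ Poly_Mapping.lookup (Poly_Mapping.single i 1) j) = (\<Prod>j<n. if j = i then x j else 1)"
    by (rule prod.cong) (auto simp: lookup_single when_def)
  then show ?thesis using assms by (simp add: eval_single)
qed

lemma eval_mult: "eval n x (p * q) = eval n x p * eval n x q"
proof (induction p rule: monomial_induct)
  case (single a c)
  show ?case
  proof (induction q rule: monomial_induct)
    case (single b d)
    then show ?case
      by (simp add: mult_single eval_single lookup_add power_add prod.distrib)
  qed (simp add: distrib_left eval_add)
qed (simp add: distrib_right eval_add)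

lemma eval_sum: "eval n x (\<Sum>j\<in>J. p j) = (\<Sum>j\<in>J. eval n x (p j))"
  by (induction J rule: infinite_finite_induct) (simp_all add: eval_add)

lemma eval_prod: "eval n x (\<Prod>j\<in>J. p j) = (\<Prod>j\<in>J. eval n x (p j))"
  by (induction J rule: infinite_finite_induct) (simp_all add: eval_mult)

text \<open>
  Regarding the sum as a polynomial in the last variable, each of its coefficients is a sum of
  the same kind in fewer variables, over those \<open>a\<close> that have a given last exponent.
\<close>

lemma power_products_independent:
  fixes c :: "'b \<Rightarrow> 'k::field" and n :: nat
  assumes inf: "infinite (UNIV :: 'k set)" and fin: "finite A"
    and distinct: "\<forall>a\<in>A. \<forall>b\<in>A. (\<forall>i<n. e a i = e b i) \<longrightarrow> a = b"
    and zero: "\<forall>x. (\<Sum>a\<in>A. c a * (\<Prod>i<n. x i ^ e a i)) = 0"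
    and a: "a \<in> A"
  shows "c a = 0"
  using fin distinct zero a
proof (induction n arbitrary: A a)
  case 0
  have "A = {a}" using 0(2,4) by auto
  then show ?case using 0(3) by simp
next
  case (Suc n)
  define A' where "A' k = {b \<in> A. e b n = k}" for k
  have fibre: "(\<Sum>b\<in>A' k. c b * (\<Prod>i<n. x i ^ e b i)) = 0" for k x
  proof -
    define p where "p = (\<Sum>b\<in>A. monom (c b * (\<Prod>i<n. x i ^ e b i)) (e b n))"
    have "poly p t = 0" for t
    proof -
      have "(\<Prod>i<n. (x(n := t)) i ^ e b i) = (\<Prod>i<n. x i ^ e b i)" for b
        by (intro prod.cong) auto
      then show ?thesis
        using Suc.prems(3)[rule_format, of "x(n := t)"]
        by (simp add: p_def poly_sum poly_monom mult.assoc)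
    qed
    then have "infinite {t. poly p t = 0}" using inf by simp
    then have "p = 0" using poly_roots_finite by blast
    then have "coeff p k = 0" by simp
    then show ?thesis
      using Suc.prems(1) by (simp add: p_def coeff_sum A'_def sum.inter_filter)
  qed
  show ?case
  proof (rule Suc.IH)
    show "finite (A' (e a n))" using Suc.prems(1) by (simp add: A'_def)
    show "\<forall>b\<in>A' (e a n). \<forall>b'\<in>A' (e a n). (\<forall>i<n. e b i = e b' i) \<longrightarrow> b = b'"
      using Suc.prems(2) by (auto simp: A'_def less_Suc_eq)
    show "\<forall>x. (\<Sum>b\<in>A' (e a n). c b * (\<Prod>i<n. x i ^ e b i)) = 0"
      using fibre by blast
    show "a \<in> A' (e a n)" using Suc.prems(4) by (simp add: A'_def)
  qed
qed

lemma eval_eq_zero_imp_zero: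
  fixes p :: "'k::field mpol"
  assumes inf: "infinite (UNIV :: 'k set)" and p: "p \<in> mpol_ring n"
    and zero: "\<And>x. eval n x p = 0"
  shows "p = 0"
proof -
  have distinct: "b = b'" if b: "b \<in> Poly_Mapping.keys p" "b' \<in> Poly_Mapping.keys p"
      and eq: "\<forall>i<n. Poly_Mapping.lookup b i = Poly_Mapping.lookup b' i" for b b'
  proof -
    have "Poly_Mapping.lookup b i = Poly_Mapping.lookup b' i" for i
    proof (cases "i < n")
      case False
      then have "i \<notin> Poly_Mapping.keys b" "i \<notin> Poly_Mapping.keys b'"
        using p b by (auto simp: mpol_ring_def)
      then show ?thesis by (simp add: in_keys_iff)
    qed (use eq in simp)
    then show ?thesis by (intro poly_mapping_eqI)
  qed
  have "Poly_Mapping.lookup p a = 0" if a: "a \<in> Poly_Mapping.keys p" for a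
    by (rule power_products_independent[OF inf finite_keys _ _ a, where n = n and e = Poly_Mapping.lookup])
       (use distinct zero in \<open>auto simp: eval_def\<close>)
  then show ?thesis by (intro poly_mapping_eqI) (auto simp: in_keys_iff)
qed

lemma pderiv_add: "mpol_pderiv i (p + q) = mpol_pderiv i p + mpol_pderiv i q"
  unfolding mpol_pderiv_def
  by (rule setsum_keys_plus_distrib[of "\<lambda>a c. Poly_Mapping.single (a - Poly_Mapping.single i 1)
        (of_nat (Poly_Mapping.lookup a i) * c)"])
     (simp_all add: distrib_left single_add)

lemma pderiv_single: "mpol_pderiv i (Poly_Mapping.single a c) =
    Poly_Mapping.single (a - Poly_Mapping.single i 1) (of_nat (Poly_Mapping.lookup a i) * c)"
  by (simp add: mpol_pderiv_def)

lemma pderiv_sum: "mpol_pderiv i (\<Sum>j\<in>J. p j) = (\<Sum>j\<in>J. mpol_pderiv i (p j))"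
  by (induction J rule: infinite_finite_induct) (simp_all add: pderiv_add, simp_all add: mpol_pderiv_def)

lemma pderiv_one: "mpol_pderiv i (1 :: 'k::field mpol) = 0"
  using pderiv_single[of i 0 "1 :: 'k"] by simp

text \<open>
  The truncated difference \<open>a - e\<^sub>i\<close> can be moved out of a sum of exponents when \<open>x\<^sub>i\<close> occurs in \<open>a\<close>;
  otherwise the coefficient is zero and the exponent is irrelevant.
\<close>

lemma pderiv_mult_monomials:
  fixes c d :: "'k::field"
  shows "mpol_pderiv i (Poly_Mapping.single a c * Poly_Mapping.single b d) =
    mpol_pderiv i (Poly_Mapping.single a c) * Poly_Mapping.single b d +
    Poly_Mapping.single a c * mpol_pderiv i (Poly_Mapping.single b d)"
proof -
  let ?e = "Poly_Mapping.single i (1::nat)"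
  let ?a = "of_nat (Poly_Mapping.lookup a i) * c" and ?b = "of_nat (Poly_Mapping.lookup b i) * d"
  have a: "Poly_Mapping.single (a - ?e + b) (?a * d) = Poly_Mapping.single (a + b - ?e) (?a * d)"
  proof (cases "Poly_Mapping.lookup a i = 0")
    case False
    then have "a - ?e + b = a + b - ?e"
      by (intro poly_mapping_eqI) (auto simp: lookup_add lookup_minus lookup_single when_def)
    then show ?thesis by simp
  qed simp
  have b: "Poly_Mapping.single (a + (b - ?e)) (c * ?b) = Poly_Mapping.single (a + b - ?e) (c * ?b)"
  proof (cases "Poly_Mapping.lookup b i = 0")
    case False
    then have "a + (b - ?e) = a + b - ?e"
      by (intro poly_mapping_eqI) (auto simp: lookup_add lookup_minus lookup_single when_def)
    then show ?thesis by simp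
  qed simp
  show ?thesis
    unfolding pderiv_single mult_single a b
    by (simp add: lookup_add algebra_simps flip: single_add)
qed

lemma pderiv_mult: "mpol_pderiv i (p * q) = mpol_pderiv i p * q + p * mpol_pderiv i q"
proof (induction p rule: monomial_induct)
  case (single a c)
  show ?case
  proof (induction q rule: monomial_induct)
    case (single b d)
    show ?case by (rule pderiv_mult_monomials)
  qed (simp add: distrib_left pderiv_add algebra_simps)
qed (simp add: distrib_right pderiv_add algebra_simps)

lemma pderiv_prod:
  assumes "finite J"
  shows "mpol_pderiv i (\<Prod>j\<in>J. l j) = (\<Sum>j\<in>J. mpol_pderiv i (l j) * (\<Prod>k\<in>J - {j}. l k))"
  using assms
proof (induction J rule: finite_induct)
  case (insert j J)
  have "(\<Prod>k\<in>insert j J - {i}. l k) = l j * (\<Prod>k\<in>J - {i}. l k)" if "i \<in> J" for i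
  proof -
    have "insert j J - {i} = insert j (J - {i})" using that insert.hyps by auto
    then show ?thesis using insert.hyps by simp
  qed
  then show ?case
    using insert by (simp add: pderiv_mult sum_distrib_left ac_simps cong: sum.cong)
qed (simp add: pderiv_one)

definition is_form :: "nat \<Rightarrow> nat \<Rightarrow> 'k::field mpol \<Rightarrow> bool" where
  "is_form n r p \<longleftrightarrow> p \<in> mpol_ring n \<and> homogeneous r p"

lemma is_form_add: "is_form n r p \<Longrightarrow> is_form n r q \<Longrightarrow> is_form n r (p + q)"
  using subsetD[OF keys_add[of p q]] unfolding is_form_def mpol_ring_def homogeneous_def by blast

lemma is_form_zero: "is_form n r 0"
  by (simp add: is_form_def mpol_ring_def homogeneous_def)

lemma is_form_const: "is_form n 0 (mconst c)"
  by (simp add: is_form_def mpol_ring_def homogeneous_def)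

lemma is_form_var: "i < n \<Longrightarrow> is_form n 1 (mvar i)"
  by (simp add: is_form_def mpol_ring_def homogeneous_def)

lemma is_form_mult:
  assumes "is_form n r p" "is_form n s q"
  shows "is_form n (r + s) (p * q)"
proof -
  have "Poly_Mapping.keys c \<subseteq> {..<n} \<and>
      (\<Sum>i\<in>Poly_Mapping.keys c. Poly_Mapping.lookup c i) = r + s" if c: "c \<in> Poly_Mapping.keys (p * q)" for c
  proof -
    obtain a b where ab: "c = a + b" "a \<in> Poly_Mapping.keys p" "b \<in> Poly_Mapping.keys q"
      using c subsetD[OF keys_mult[of p q]] by blast
    have "Poly_Mapping.keys a \<subseteq> {..<n}" "Poly_Mapping.keys b \<subseteq> {..<n}"
      using assms ab(2,3) by (auto simp: is_form_def mpol_ring_def)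
    then have "Poly_Mapping.keys c \<subseteq> {..<n}"
      using keys_add[of a b] ab(1) by blast
    then show ?thesis
      using assms ab setsum_keys_plus_distrib[of "\<lambda>_ c. c" a b]
      by (simp add: is_form_def homogeneous_def)
  qed
  then show ?thesis by (auto simp: is_form_def mpol_ring_def homogeneous_def)
qed

lemma is_form_scaled: "is_form n r p \<Longrightarrow> is_form n r (mconst c * p)"
  using is_form_mult[OF is_form_const, of n r p c] by simp

lemma is_form_sum: "(\<And>j. j \<in> J \<Longrightarrow> is_form n r (p j)) \<Longrightarrow> is_form n r (\<Sum>j\<in>J. p j)"
  by (induction J rule: infinite_finite_induct) (simp_all add: is_form_zero is_form_add)

lemma is_form_prod:
  "(\<And>j. j \<in> J \<Longrightarrow> is_form n 1 (p j)) \<Longrightarrow> is_form n (card J) (\<Prod>j\<in>J. p j)"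
proof (induction J rule: infinite_finite_induct)
  case (insert j J)
  then show ?case using is_form_mult[of n 1 "p j" "card J" "\<Prod>j\<in>J. p j"] by simp
qed (use is_form_const[of n 1] in simp_all)

lemma line_degree_le_eval:
  assumes "is_form n r p"
  shows "line_degree_le r (\<lambda>x. eval n x p)"
  unfolding eval_def
proof (intro line_degree_le_sum line_degree_le_scaled)
  fix a assume a: "a \<in> Poly_Mapping.keys p"
  then have "(\<Sum>i<n. Poly_Mapping.lookup a i) = (\<Sum>i\<in>Poly_Mapping.keys a. Poly_Mapping.lookup a i)"
    using assms by (intro sum.mono_neutral_right) (auto simp: is_form_def mpol_ring_def in_keys_iff)
  also have "\<dots> = r" using a assms by (simp add: is_form_def homogeneous_def)
  finally show "line_degree_le r (\<lambda>x. \<Prod>i<n. x i ^ Poly_Mapping.lookup a i)"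
    using line_degree_le_prod[of "{..<n}" "Poly_Mapping.lookup a" "\<lambda>i x. x i ^ Poly_Mapping.lookup a i"]
      line_degree_le_power by auto
qed

definition linear_coeff :: "'k::field mpol \<Rightarrow> nat \<Rightarrow> 'k" where
  "linear_coeff p i = Poly_Mapping.lookup p (Poly_Mapping.single i 1)"

lemma linear_form_expansion:
  assumes "is_form n 1 p"
  shows "p = (\<Sum>i<n. mconst (linear_coeff p i) * mvar i)"
proof -
  let ?e = "\<lambda>i::nat. Poly_Mapping.single i (1::nat)"
  have sub: "Poly_Mapping.keys p \<subseteq> ?e ` {..<n}"
  proof
    fix a assume a: "a \<in> Poly_Mapping.keys p"
    then have "(\<Sum>i\<in>Poly_Mapping.keys a. Poly_Mapping.lookup a i) = Suc 0"
      and keys: "Poly_Mapping.keys a \<subseteq> {..<n}"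
      using assms by (auto simp: is_form_def homogeneous_def mpol_ring_def)
    then obtain i where i: "i \<in> Poly_Mapping.keys a" "Poly_Mapping.lookup a i = 1"
      "\<forall>j\<in>Poly_Mapping.keys a. i \<noteq> j \<longrightarrow> Poly_Mapping.lookup a j = 0"
      by (auto simp: sum_eq_Suc0_iff)
    have "a = ?e i"
    proof (rule poly_mapping_eqI)
      fix j show "Poly_Mapping.lookup a j = Poly_Mapping.lookup (?e i) j"
        using i by (auto simp: lookup_single when_def in_keys_iff)
    qed
    then show "a \<in> ?e ` {..<n}" using i(1) keys by auto
  qed
  have inj: "inj_on ?e {..<n}"
    by (rule inj_onI) (metis keys_single singleton_inject zero_neq_one)
  have "p = (\<Sum>a\<in>Poly_Mapping.keys p. Poly_Mapping.single a (Poly_Mapping.lookup p a))"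
    by (simp add: sum_monomials)
  also have "\<dots> = (\<Sum>a\<in>?e ` {..<n}. Poly_Mapping.single a (Poly_Mapping.lookup p a))"
    using sub by (intro sum.mono_neutral_left) (auto simp: in_keys_iff)
  also have "\<dots> = (\<Sum>i<n. mconst (linear_coeff p i) * mvar i)"
    unfolding sum.reindex[OF inj] by (simp add: mult_single linear_coeff_def)
  finally show ?thesis .
qed

lemma eval_linear_form:
  assumes "is_form n 1 p"
  shows "eval n x p = dot n (linear_coeff p) x"
proof -
  have "eval n x p = eval n x (\<Sum>i<n. mconst (linear_coeff p i) * mvar i)"
    using linear_form_expansion[OF assms] by simp
  also have "\<dots> = dot n (linear_coeff p) x"
    unfolding eval_sum eval_mult eval_const dot_def by (intro sum.cong refl arg_cong2[where f = "(*)"] eval_var) simp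
  finally show ?thesis .
qed

lemma pderiv_linear_form:
  assumes "is_form n 1 p" "i < n"
  shows "mpol_pderiv i p = mconst (linear_coeff p i)"
proof -
  have "mpol_pderiv i p = mpol_pderiv i (\<Sum>k<n. mconst (linear_coeff p k) * mvar k)"
    using linear_form_expansion[OF assms(1)] by simp
  also have "\<dots> = (\<Sum>k<n. if k = i then mconst (linear_coeff p k) else 0)"
    unfolding pderiv_sum mult_single pderiv_single
    by (intro sum.cong) (auto simp: lookup_single when_def)
  also have "\<dots> = mconst (linear_coeff p i)" using assms(2) by simp
  finally show ?thesis .
qed

section \<open>From generic arrangements to vectors in general position\<close>

text \<open>
  Otherwise \<open>x\<^sub>i\<close> and the \<open>n\<close> forms would be \<open>n + 1\<close> linearly independent elements of the span of
  \<open>x\<^sub>0, \<dots>, x\<^bsub>n-1\<^esub>\<close>.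
\<close>

lemma var_in_span_of_independent:
  fixes l :: "nat \<Rightarrow> 'k::field mpol"
  assumes T: "finite T" "inj_on l T" "card T = n" and indep: "mpol.independent (l ` T)"
    and form: "\<And>s. s \<in> T \<Longrightarrow> is_form n 1 (l s)" and i: "i < n"
  shows "\<exists>c. mvar i = (\<Sum>s\<in>T. mpol_scale (c s) (l s))"
proof -
  let ?X = "(mvar :: nat \<Rightarrow> 'k mpol) ` {..<n}"
  have in_span: "l s \<in> mpol.span ?X" if s: "s \<in> T" for s
  proof -
    have "(\<Sum>i<n. mpol_scale (linear_coeff (l s) i) (mvar i)) \<in> mpol.span ?X"
      by (intro mpol.span_sum mpol.span_scale mpol.span_base) auto
    then show ?thesis
      using linear_form_expansion[OF form[OF s]] by (simp add: mpol_scale_def)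
  qed
  have card: "card ?X \<le> card (l ` T)"
    using T card_image_le[of "{..<n}" mvar] by (simp add: card_image)
  have "mvar i \<in> mpol.span (l ` T)"
  proof (rule ccontr)
    assume "mvar i \<notin> mpol.span (l ` T)"
    then have new: "mvar i \<notin> l ` T"
      using mpol.span_base by blast
    have "mpol.independent (insert (mvar i) (l ` T))"
      using indep \<open>mvar i \<notin> mpol.span (l ` T)\<close> new by (simp add: mpol.independent_insert)
    moreover have "insert (mvar i) (l ` T) \<subseteq> mpol.span ?X"
      using in_span i by (auto intro: mpol.span_base)
    ultimately have "card (insert (mvar i) (l ` T)) \<le> card ?X"
      using mpol.independent_span_bound by blast
    then show False using card T(1) new by simp
  qed
  then obtain u where "mvar i = (\<Sum>v\<in>l ` T. mpol_scale (u v) v)"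
    using T(1) by (auto simp: mpol.span_finite)
  then show ?thesis
    by (intro exI[of _ "u \<circ> l"]) (simp add: sum.reindex[OF T(2)])
qed

lemma independent_familyD:
  fixes l :: "nat \<Rightarrow> 'k::field mpol"
  assumes T: "finite T" "inj_on l T" and indep: "mpol.independent (l ` T)"
    and zero: "(\<Sum>s\<in>T. mpol_scale (d s) (l s)) = 0" and s: "s \<in> T"
  shows "d s = 0"
proof -
  have "(\<Sum>v\<in>l ` T. mpol_scale (d (inv_into T l v)) v) = 0"
    using zero by (simp add: sum.reindex[OF T(2)] T(2) cong: sum.cong)
  then have "d (inv_into T l (l s)) = 0"
    using T(1) s by (intro mpol.independentD[OF indep]) auto
  then show ?thesis using T(2) s by simp
qed

lemma generic_arrangement_forms:
  assumes "generic_arrangement n m l" "j < m"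
  shows "is_form n 1 (l j)"
  using assms by (simp add: generic_arrangement_def central_arrangement_def is_form_def)

lemma generic_arrangement_inj:
  assumes "generic_arrangement n m l"
  shows "inj_on l {..<m}"
proof (rule inj_onI, rule ccontr)
  fix i j assume "i \<in> {..<m}" "j \<in> {..<m}" "l i = l j" "i \<noteq> j"
  then have "l i = mpol_scale 1 (l j)" "\<nexists>c. l i = mpol_scale c (l j)"
    using assms by (auto simp: generic_arrangement_def central_arrangement_def)
  then show False by blast
qed

text \<open>
  The coefficients \<open>c\<close> that express the variables by the forms are the inverse of the coefficient
  matrix of the forms. Substituting the variables into \<open>l\<^sub>t\<close> gives a linear relation between the
  forms, whose coefficients are zero; this is the second claim.
\<close>

lemma ex_dual_coefficients:
  fixes l :: "nat \<Rightarrow> 'k::field mpol"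
  assumes T: "finite T" "inj_on l T" "card T = n" and indep: "mpol.independent (l ` T)"
    and form: "\<And>s. s \<in> T \<Longrightarrow> is_form n 1 (l s)"
  shows "\<exists>c. (\<forall>i<n. mvar i = (\<Sum>s\<in>T. mpol_scale (c i s) (l s))) \<and>
    (\<forall>t\<in>T. \<forall>s\<in>T. dot n (linear_coeff (l t)) (\<lambda>i. c i s) = (if s = t then 1 else 0))"
proof -
  have "\<forall>i\<in>{..<n}. \<exists>c. mvar i = (\<Sum>s\<in>T. mpol_scale (c s) (l s))"
    using var_in_span_of_independent[OF T indep form] by auto
  then obtain c where c: "\<And>i. i < n \<Longrightarrow> mvar i = (\<Sum>s\<in>T. mpol_scale (c i s) (l s))"
    by (metis lessThan_iff)
  have "dot n (linear_coeff (l t)) (\<lambda>i. c i s) = (if s = t then 1 else 0)"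
    if t: "t \<in> T" and s: "s \<in> T" for t s
  proof -
    define d where "d s = dot n (linear_coeff (l t)) (\<lambda>i. c i s)" for s
    have "l t = (\<Sum>i<n. mpol_scale (linear_coeff (l t) i) (mvar i))"
      using linear_form_expansion[OF form[OF t]] by (simp add: mpol_scale_def)
    also have "\<dots> = (\<Sum>i<n. mpol_scale (linear_coeff (l t) i) (\<Sum>s\<in>T. mpol_scale (c i s) (l s)))"
      by (intro sum.cong refl arg_cong2[where f = mpol_scale] c) simp
    also have "\<dots> = (\<Sum>i<n. \<Sum>s\<in>T. mpol_scale (linear_coeff (l t) i * c i s) (l s))"
      by (simp add: mpol.scale_sum_right)
    also have "\<dots> = (\<Sum>s\<in>T. mpol_scale (d s) (l s))"
      unfolding d_def dot_def mpol.scale_sum_left by (rule sum.swap)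
    finally have lt: "l t = (\<Sum>s\<in>T. mpol_scale (d s) (l s))" .
    have "(\<Sum>s\<in>T. mpol_scale (d s - (if s = t then 1 else 0)) (l s))
      = (\<Sum>s\<in>T. mpol_scale (d s) (l s)) - (\<Sum>s\<in>T. if s = t then l s else 0)"
      unfolding sum_subtractf[symmetric]
      by (intro sum.cong) (auto simp: mpol.scale_left_diff_distrib)
    also have "\<dots> = 0" using lt[symmetric] t T(1) by simp
    finally have "d s - (if s = t then 1 else 0) = 0"
      by (rule independent_familyD[OF T(1,2) indep _ s])
    then show ?thesis by (simp add: d_def)
  qed
  then show ?thesis using c by blast
qed

lemma generic_arrangement_general_position:
  fixes l :: "nat \<Rightarrow> 'k::field mpol"
  assumes inf: "infinite (UNIV :: 'k set)" and le: "n \<le> m" and gen: "generic_arrangement n m l"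
  shows "general_position n m (\<lambda>j. linear_coeff (l j))"
proof -
  have dual: "\<exists>c. (\<forall>i<n. mvar i = (\<Sum>s\<in>T. mpol_scale (c i s) (l s))) \<and>
      (\<forall>t\<in>T. \<forall>s\<in>T. dot n (linear_coeff (l t)) (\<lambda>i. c i s) = (if s = t then 1 else 0))"
    if T: "T \<subseteq> {..<m}" "card T = n" for T
  proof (rule ex_dual_coefficients)
    show "finite T" using T(1) finite_subset by blast
    show "inj_on l T" using inj_on_subset[OF generic_arrangement_inj[OF gen] T(1)] .
    show "mpol.independent (l ` T)" using gen T by (auto simp: generic_arrangement_def)
    show "is_form n 1 (l s)" if "s \<in> T" for s
      using generic_arrangement_forms[OF gen] T(1) that by auto
  qed (fact T(2))
  show ?thesis
  proof unfold_locales
    fix T x i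
    assume T: "T \<subseteq> {..<m}" "card T = n"
      and x: "\<forall>s\<in>T. dot n (linear_coeff (l s)) x = 0" and i: "i < n"
    obtain c where "mvar i = (\<Sum>s\<in>T. mpol_scale (c i s) (l s))"
      using dual[OF T] i by blast
    then have "x i = eval n x (\<Sum>s\<in>T. mpol_scale (c i s) (l s))"
      using eval_var[OF i, of x] by simp
    also have "\<dots> = (\<Sum>s\<in>T. c i s * eval n x (l s))"
      by (simp only: eval_sum mpol_scale_def eval_mult eval_const)
    also have "\<dots> = 0"
    proof (intro sum.neutral ballI)
      fix s assume s: "s \<in> T"
      then have "eval n x (l s) = dot n (linear_coeff (l s)) x"
        using T(1) by (intro eval_linear_form generic_arrangement_forms[OF gen]) auto
      then show "c i s * eval n x (l s) = 0" using x s by simp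
    qed
    finally show "x i = 0" .
  next
    fix T s
    assume T: "T \<subseteq> {..<m}" "card T = n" and s: "s \<in> T"
    obtain c where
      "\<forall>t\<in>T. \<forall>s\<in>T. dot n (linear_coeff (l t)) (\<lambda>i. c i s) = (if s = t then 1 else 0)"
      using dual[OF T] by blast
    then show "\<exists>q. dot n (linear_coeff (l s)) q = 1 \<and> (\<forall>t\<in>T - {s}. dot n (linear_coeff (l t)) q = 0)"
      using s by (intro exI[of _ "\<lambda>i. c i s"]) auto
  qed (use inf le in auto)
qed

section \<open>The syzygies of the partial derivatives\<close>

lemma pderiv_product_of_forms:
  fixes l :: "nat \<Rightarrow> 'k::field mpol"
  assumes "\<And>j. j < m \<Longrightarrow> is_form n 1 (l j)" "i < n"
  shows "mpol_pderiv i (\<Prod>j<m. l j) =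
    (\<Sum>j<m. mconst (linear_coeff (l j) i) * (\<Prod>k\<in>{..<m} - {j}. l k))"
proof -
  have "mpol_pderiv i (\<Prod>j<m. l j) = (\<Sum>j<m. mpol_pderiv i (l j) * (\<Prod>k\<in>{..<m} - {j}. l k))"
    by (rule pderiv_prod) simp
  also have "\<dots> = (\<Sum>j<m. mconst (linear_coeff (l j) i) * (\<Prod>k\<in>{..<m} - {j}. l k))"
    using assms by (intro sum.cong refl arg_cong2[where f = "(*)"] pderiv_linear_form) auto
  finally show ?thesis .
qed

lemma syzygy_annihilates:
  fixes l :: "nat \<Rightarrow> 'k::field mpol"
  assumes form: "\<And>j. j < m \<Longrightarrow> is_form n 1 (l j)"
    and syz: "(\<Sum>i<n. P i * mpol_pderiv i (\<Prod>j<m. l j)) = 0"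
  shows "(\<Sum>j<m. dot n (linear_coeff (l j)) (\<lambda>i. eval n x (P i)) *
      (\<Prod>k\<in>{..<m} - {j}. dot n (linear_coeff (l k)) x)) = 0"
proof -
  let ?M = "\<lambda>j. \<Prod>k\<in>{..<m} - {j}. dot n (linear_coeff (l k)) x"
  have pd: "mpol_pderiv i (\<Prod>j<m. l j) = (\<Sum>j<m. mconst (linear_coeff (l j) i) * (\<Prod>k\<in>{..<m} - {j}. l k))"
    if "i < n" for i
    using form that by (rule pderiv_product_of_forms)
  have M: "eval n x (\<Prod>k\<in>{..<m} - {j}. l k) = ?M j" for j
    unfolding eval_prod by (intro prod.cong refl) (simp add: eval_linear_form[OF form])
  have "(\<Sum>j<m. dot n (linear_coeff (l j)) (\<lambda>i. eval n x (P i)) * ?M j)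
    = (\<Sum>j<m. \<Sum>i<n. eval n x (P i) * (linear_coeff (l j) i * ?M j))"
    unfolding dot_def sum_distrib_right by (simp add: ac_simps)
  also have "\<dots> = (\<Sum>i<n. \<Sum>j<m. eval n x (P i) * (linear_coeff (l j) i * ?M j))"
    by (rule sum.swap)
  also have "\<dots> = (\<Sum>i<n. eval n x (P i * mpol_pderiv i (\<Prod>j<m. l j)))"
    by (intro sum.cong refl)
       (simp add: pd eval_mult eval_sum M sum_distrib_left)
  also have "\<dots> = 0"
    unfolding eval_sum[symmetric] syz by simp
  finally show ?thesis .
qed

text \<open>
  Over an infinite field a polynomial is determined by its values, so the vanishing theorem for
  vector fields given by functions applies to the values of a syzygy.
\<close>

lemma low_degree_syzygy_zero:
  fixes l :: "nat \<Rightarrow> 'k::field mpol"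
  assumes n: "n \<ge> 2" and r: "r + n \<le> m" and inf: "infinite (UNIV :: 'k set)"
    and char: "\<not> CHAR('k) dvd m" and gen: "generic_arrangement n m l"
    and P: "P \<in> jacobian_syz_deg n (defining_poly m l) r"
  shows "P = (\<lambda>_. 0)"
proof
  fix i
  note form = generic_arrangement_forms[OF gen]
  interpret general_position n m "\<lambda>j. linear_coeff (l j)"
    using generic_arrangement_general_position[OF inf _ gen] r by simp
  have P': "\<And>i. i < n \<Longrightarrow> is_form n r (P i)" "\<And>i. i \<ge> n \<Longrightarrow> P i = 0"
    "(\<Sum>i<n. P i * mpol_pderiv i (\<Prod>j<m. l j)) = 0"
    using P by (auto simp: jacobian_syz_deg_def jacobian_syz_def is_form_def defining_poly_def)
  show "P i = 0"
  proof (cases "i < n")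
    case True
    have "eval n x (P i) = 0" for x
    proof (rule low_degree_annihilator_zero[OF n _ r _ _ True, of "\<lambda>x i. eval n x (P i)"])
      show "line_degree_le r (\<lambda>x. eval n x (P i))" if "i < n" for i
        by (rule line_degree_le_eval[OF P'(1)[OF that]])
      show "of_nat m \<noteq> (0 :: 'k)"
        using char by (simp add: of_nat_eq_0_iff_char_dvd)
    qed (rule syzygy_annihilates[OF form P'(3)])
    then show ?thesis
      using eval_eq_zero_imp_zero[OF inf] P'(1)[OF True] by (auto simp: is_form_def)
  qed (use P'(2) in simp)
qed

lemma euler_formula_product_of_forms:
  fixes l :: "nat \<Rightarrow> 'k::field mpol"
  assumes form: "\<And>j. j < m \<Longrightarrow> is_form n 1 (l j)"
  shows "(\<Sum>i<n. mvar i * mpol_pderiv i (\<Prod>j<m. l j)) = of_nat m * (\<Prod>j<m. l j)"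
proof -
  let ?M = "\<lambda>j. \<Prod>k\<in>{..<m} - {j}. l k"
  have pd: "mpol_pderiv i (\<Prod>j<m. l j) = (\<Sum>j<m. mconst (linear_coeff (l j) i) * (\<Prod>k\<in>{..<m} - {j}. l k))"
    if "i < n" for i
    using form that by (rule pderiv_product_of_forms)
  have "(\<Sum>i<n. mvar i * mpol_pderiv i (\<Prod>j<m. l j))
    = (\<Sum>i<n. \<Sum>j<m. (mconst (linear_coeff (l j) i) * mvar i) * ?M j)"
    by (intro sum.cong refl)
       (simp add: pd sum_distrib_left ac_simps del: One_nat_def)
  also have "\<dots> = (\<Sum>j<m. (\<Sum>i<n. mconst (linear_coeff (l j) i) * mvar i) * ?M j)"
    unfolding sum_distrib_right by (rule sum.swap)
  also have "\<dots> = (\<Sum>j<m. \<Prod>k<m. l k)"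
  proof (intro sum.cong refl)
    fix j assume j: "j \<in> {..<m}"
    then have "(\<Sum>i<n. mconst (linear_coeff (l j) i) * mvar i) = l j"
      using linear_form_expansion[OF form[of j]] by simp
    then show "(\<Sum>i<n. mconst (linear_coeff (l j) i) * mvar i) * ?M j = (\<Prod>k<m. l k)"
      using j by (simp only: prod.remove[OF finite_lessThan j])
  qed
  finally show ?thesis by simp
qed

lemma directional_derivative_product_of_forms:
  fixes l :: "nat \<Rightarrow> 'k::field mpol"
  assumes form: "\<And>j. j < m \<Longrightarrow> is_form n 1 (l j)"
  shows "(\<Sum>i<n. mconst (q i) * mpol_pderiv i (\<Prod>j<m. l j)) =
    (\<Sum>j<m. mconst (dot n (linear_coeff (l j)) q) * (\<Prod>k\<in>{..<m} - {j}. l k))"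
proof -
  let ?M = "\<lambda>j. \<Prod>k\<in>{..<m} - {j}. l k"
  have pd: "mpol_pderiv i (\<Prod>j<m. l j) = (\<Sum>j<m. mconst (linear_coeff (l j) i) * (\<Prod>k\<in>{..<m} - {j}. l k))"
    if "i < n" for i
    using form that by (rule pderiv_product_of_forms)
  have "(\<Sum>i<n. mconst (q i) * mpol_pderiv i (\<Prod>j<m. l j))
    = (\<Sum>i<n. \<Sum>j<m. mconst (linear_coeff (l j) i * q i) * ?M j)"
    by (intro sum.cong refl)
       (simp add: pd sum_distrib_left mconst_mult ac_simps)
  also have "\<dots> = (\<Sum>j<m. (\<Sum>i<n. mconst (linear_coeff (l j) i * q i)) * ?M j)"
    unfolding sum_distrib_right by (rule sum.swap)
  finally show ?thesis by (simp add: dot_def mconst_sum)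
qed

text \<open>
  Let \<open>q\<close> span the line on which the first \<open>n - 1\<close> forms vanish, let \<open>g\<close> be the product of the
  remaining \<open>m - n + 1\<close> forms, and let \<open>D\<close> be the derivative in direction \<open>q\<close>. As \<open>D\<close> kills the
  first \<open>n - 1\<close> forms, \<open>D f\<close> is their product times \<open>h = D g\<close>, so that \<open>g D f = h f\<close>. Hence
  \<open>g D - (h / m) E\<close> kills \<open>f\<close>, where \<open>E\<close> is the Euler field, for which \<open>E f = m f\<close>.
\<close>

lemma ex_syzygy:
  fixes l :: "nat \<Rightarrow> 'k::field mpol"
  assumes n: "n \<ge> 2" and m: "m \<ge> n" and inf: "infinite (UNIV :: 'k set)"
    and char: "\<not> CHAR('k) dvd m" and gen: "generic_arrangement n m l"
  shows "\<exists>P\<in>jacobian_syz_deg n (defining_poly m l) (m - n + 1). P \<noteq> (\<lambda>_. 0)"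
proof -
  note form = generic_arrangement_forms[OF gen]
  let ?a = "\<lambda>j. linear_coeff (l j)"
  interpret general_position n m ?a
    using generic_arrangement_general_position[OF inf m gen] .
  have m0: "of_nat m \<noteq> (0 :: 'k)"
    using char by (simp add: of_nat_eq_0_iff_char_dvd)
  obtain q where q: "dot n (?a (n - 1)) q = 1" "\<forall>t\<in>{..<n} - {n - 1}. dot n (?a t) q = 0"
    using dual_vector[of "{..<n}" "n - 1"] n m by auto
  define A J where "A = {..<n - 1}" and "J = {n - 1..<m}"
  have AJ: "{..<m} = A \<union> J" "A \<inter> J = {}" "finite A" "finite J" "card J = m - n + 1"
    using n m by (auto simp: A_def J_def)
  have qA: "dot n (?a t) q = 0" if "t \<in> A" for t
    using q(2) that by (auto simp: A_def)
  define f where "f = (\<Prod>j<m. l j)"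
  define g where "g = (\<Prod>j\<in>J. l j)"
  define h where "h = (\<Sum>j\<in>J. mconst (dot n (?a j) q) * (\<Prod>k\<in>J - {j}. l k))"
  have f: "f = prod l A * g"
    unfolding f_def g_def AJ(1) using AJ by (intro prod.union_disjoint)
  have formJ: "is_form n 1 (l j)" if "j \<in> J" for j
    using form that by (auto simp: J_def)
  have "is_form n (card J) g" unfolding g_def by (intro is_form_prod formJ)
  then have form_g: "is_form n (m - n + 1) g" unfolding AJ .
  have form_h: "is_form n (m - n) h"
    unfolding h_def
  proof (intro is_form_sum is_form_scaled)
    fix j assume j: "j \<in> J"
    have "is_form n (card (J - {j})) (\<Prod>k\<in>J - {j}. l k)"
      by (intro is_form_prod formJ) auto
    then show "is_form n (m - n) (\<Prod>k\<in>J - {j}. l k)"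
      using j AJ by simp
  qed
  define P where "P i = (if i < n then mconst (q i) * g + mconst (- inverse (of_nat m)) * (h * mvar i) else 0)" for i
  have deriv: "(\<Sum>i<n. mconst (q i) * mpol_pderiv i f) = prod l A * h"
  proof -
    have "(\<Sum>i<n. mconst (q i) * mpol_pderiv i f)
      = (\<Sum>j\<in>{..<m}. mconst (dot n (?a j) q) * (\<Prod>k\<in>{..<m} - {j}. l k))"
      unfolding f_def by (rule directional_derivative_product_of_forms[OF form])
    also have "\<dots> = (\<Sum>j\<in>J. mconst (dot n (?a j) q) * (\<Prod>k\<in>{..<m} - {j}. l k))"
      using AJ qA by (intro sum.mono_neutral_right) auto
    also have "\<dots> = (\<Sum>j\<in>J. prod l A * (mconst (dot n (?a j) q) * (\<Prod>k\<in>J - {j}. l k)))"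
    proof (intro sum.cong refl)
      fix j assume j: "j \<in> J"
      then have "{..<m} - {j} = A \<union> (J - {j})" "A \<inter> (J - {j}) = {}"
        using AJ by auto
      then have "(\<Prod>k\<in>{..<m} - {j}. l k) = prod l A * (\<Prod>k\<in>J - {j}. l k)"
        using AJ by (simp add: prod.union_disjoint)
      then show "mconst (dot n (?a j) q) * (\<Prod>k\<in>{..<m} - {j}. l k)
        = prod l A * (mconst (dot n (?a j) q) * (\<Prod>k\<in>J - {j}. l k))"
        by (simp add: mult.left_commute)
    qed
    finally show ?thesis by (simp add: h_def sum_distrib_left)
  qed
  have euler: "(\<Sum>i<n. mvar i * mpol_pderiv i f) = of_nat m * f"
    unfolding f_def by (rule euler_formula_product_of_forms[OF form])
  have regroup: "(a * b + c * (d * e)) * D = b * (a * D) + c * d * (e * D)"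
    for a b c d e D :: "'k mpol"
    by (simp add: algebra_simps)
  have "(\<Sum>i<n. P i * mpol_pderiv i f)
    = (\<Sum>i<n. g * (mconst (q i) * mpol_pderiv i f) +
        mconst (- inverse (of_nat m)) * h * (mvar i * mpol_pderiv i f))"
    by (intro sum.cong refl) (simp only: P_def lessThan_iff if_True regroup)
  also have "\<dots> = g * (\<Sum>i<n. mconst (q i) * mpol_pderiv i f) +
        mconst (- inverse (of_nat m)) * h * (\<Sum>i<n. mvar i * mpol_pderiv i f)"
    by (simp only: sum.distrib sum_distrib_left)
  also have "\<dots> = g * (prod l A * h) + mconst (- inverse (of_nat m)) * h * (of_nat m * f)"
    unfolding deriv euler ..
  also have "\<dots> = f * h + (mconst (- inverse (of_nat m)) * mconst (of_nat m)) * (f * h)"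
    by (simp add: f ac_simps)
  also have "mconst (- inverse (of_nat m)) * mconst (of_nat m) = (- 1 :: 'k mpol)"
    unfolding mconst_mult[symmetric] using m0 by (simp add: single_uminus)
  finally have syz: "(\<Sum>i<n. P i * mpol_pderiv i f) = 0" by simp
  have form_P: "is_form n (m - n + 1) (P i)" if "i < n" for i
    unfolding P_def if_P[OF that]
    using is_form_mult[OF form_h is_form_var[OF that]]
    by (intro is_form_add is_form_scaled form_g)
  have "P \<in> jacobian_syz_deg n (defining_poly m l) (m - n + 1)"
    using form_P syz
    by (auto simp: jacobian_syz_deg_def jacobian_syz_def defining_poly_def f_def is_form_def P_def)
  moreover have "P \<noteq> (\<lambda>_. 0)"
  proof
    assume P0: "P = (\<lambda>_. 0)"
    obtain x where x: "\<And>j. j < m \<Longrightarrow> dot n (?a j) x \<noteq> 0"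
      using ex_point_off_hyperplanes[of "{}"] n by auto
    \<comment> \<open>At a point \<open>x\<close> off all hyperplanes, vanishing of \<open>P\<close> would make \<open>g(x) q\<close> proportional to \<open>x\<close>.
      The form \<open>l\<^sub>0\<close> kills \<open>q\<close> but not \<open>x\<close>, so the factor would be zero, and \<open>q\<close> as well.\<close>
    define c where "c = - inverse (of_nat m) * eval n x h"
    have gx: "eval n x g \<noteq> 0"
      using x AJ by (auto simp: g_def eval_prod eval_linear_form[OF formJ])
    have rel: "eval n x g * q i + c * x i = 0" if "i < n" for i
    proof -
      have "eval n x (P i) = 0" using P0 by simp
      then show ?thesis
        unfolding P_def if_P[OF that] eval_add eval_mult eval_const eval_var[OF that] c_def
        by (simp add: ac_simps)
    qed
    have lin: "eval n x g * dot n (?a j) q + c * dot n (?a j) x = 0" for j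
    proof -
      have "eval n x g * dot n (?a j) q + c * dot n (?a j) x
        = (\<Sum>i<n. ?a j i * (eval n x g * q i + c * x i))"
        by (simp add: dot_def sum_distrib_left distrib_left sum.distrib ac_simps)
      then show ?thesis using rel by simp
    qed
    have "c = 0" using lin[of 0] qA[of 0] x[of 0] n m by (simp add: A_def)
    then show False using lin[of "n - 1"] q(1) gx by simp
  qed
  ultimately show ?thesis by blast
qed

theorem proposition1p2:
  fixes n m :: nat and l :: "nat \<Rightarrow> 'k::field mpol"
  assumes "n \<ge> 2" and "m \<ge> n + 1"
    and "infinite (UNIV :: 'k set)"
    and "\<not> CHAR('k) dvd m"
    and "generic_arrangement n m l"
  shows "syz_initial_degree n m l = m - n + 1"
  unfolding syz_initial_degree_def
proof (rule Least_equality)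
  show "jacobian_syz_deg n (defining_poly m l) (m - n + 1) \<noteq> {\<lambda>_. 0}"
    using ex_syzygy[of n m l] assms by auto
next
  fix r assume r: "jacobian_syz_deg n (defining_poly m l) r \<noteq> {\<lambda>_. 0}"
  have "(\<lambda>_. 0) \<in> jacobian_syz_deg n (defining_poly m l) r"
    by (simp add: jacobian_syz_deg_def jacobian_syz_def mpol_ring_def homogeneous_def)
  then obtain P where "P \<in> jacobian_syz_deg n (defining_poly m l) r" "P \<noteq> (\<lambda>_. 0)"
    using r by blast
  then have "\<not> r + n \<le> m"
    using low_degree_syzygy_zero assms by blast
  then show "m - n + 1 \<le> r" using assms(2) by linarith
qed

end
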